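(* Let $(\mathfrak{g},[\cdot,\cdot])$ be a Leibniz algebra, $(V,\rho^L,\rho^R)$ a representation of it, $H:\mathfrak{g}\otimes\mathfrak{g}\to V$ a $2$-cocycle of $\mathfrak{g}$ with coefficients in $V$, and $K:V\to\mathfrak{g}$ an $H$-twisted relative Rota-Baxter operator. Then the vector space $V$ carries a Leibniz algebra structure with the bracket $$[u,v]_K:=\rho^L(Ku)v+\rho^R(Kv)u+H(Ku,Kv),\qquad u,v\in V.$$
   Context: All vector spaces are finite-dimensional over $\mathbb{C}$. A Leibniz algebra is a vector space $\mathfrak{g}$ with a bilinear bracket satisfying $[x,[y,z]]=[[x,y],z]+[y,[x,z]]$ for all $x,y,z\in\mathfrak{g}$. A representation of $\mathfrak{g}$ is a triple $(V,\rho^L,\rho^R)$ with $V$ a vector space and linear maps $\rho^L,\rho^R:\mathfrak{g}\to gl(V)$ such that for all $x,y\in\mathfrak{g}$: $\rho^L([x,y])=\rho^L(x)\rho^L(y)-\rho^L(y)\rho^L(x)$, $\rho^R([x,y])=\rho^L(x)\rho^R(y)-\rho^R(y)\rho^L(x)$, and $\rho^R([x,y])=\rho^L(x)\rho^R(y)+\rho^R(y)\rho^R(x)$. A $2$-cocycle of $\mathfrak{g}$ with coefficients in $V$ is a bilinear map $H:\mathfrak{g}\otimes\mathfrak{g}\to V$ with $\rho^L(x)H(y,z)-\rho^L(y)H(x,z)-\rho^R(z)H(x,y)-H([x,y],z)-H(y,[x,z])+H(x,[y,z])=0$ for all $x,y,z\in\mathfrak{g}$. A linear map $K:V\to\mathfrak{g}$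 is an $H$-twisted relative Rota-Baxter operator if $[Ku,Kv]=K(\rho^L(Ku)v+\rho^R(Kv)u+H(Ku,Kv))$ for all $u,v\in V$. *)

theory Defs
  imports Complex_Main
begin

locale fin_dim_complex_space = vector_space scale
  for scale :: "complex \<Rightarrow> 'a::ab_group_add \<Rightarrow> 'a" +
  assumes finite_dimensional: "\<exists>B. finite B \<and> span B = UNIV"

definition bilinear_map ::
  "(complex \<Rightarrow> 'a::ab_group_add \<Rightarrow> 'a) \<Rightarrow> (complex \<Rightarrow> 'b::ab_group_add \<Rightarrow> 'b) \<Rightarrow>
   (complex \<Rightarrow> 'c::ab_group_add \<Rightarrow> 'c) \<Rightarrow> ('a \<Rightarrow> 'b \<Rightarrow> 'c) \<Rightarrow> bool"
  where "bilinear_map sa sb sc f \<longleftrightarrow>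
    (\<forall>x. Vector_Spaces.linear sb sc (f x)) \<and>
    (\<forall>y. Vector_Spaces.linear sa sc (\<lambda>x. f x y))"

locale leibniz_algebra = fin_dim_complex_space scale
  for scale :: "complex \<Rightarrow> 'g::ab_group_add \<Rightarrow> 'g"
  and bracket :: "'g \<Rightarrow> 'g \<Rightarrow> 'g" +
  assumes bilinear_bracket: "bilinear_map scale scale scale bracket"
  and leibniz: "bracket x (bracket y z) = bracket (bracket x y) z + bracket y (bracket x z)"

text \<open>
  A linear map from \<open>\<gg>\<close> to \<open>gl(V)\<close> is encoded in curried form, as a bilinear map
  \<open>\<gg> \<times> V \<rightarrow> V\<close>: each \<open>\<rho> x\<close> is linear on \<open>V\<close>, and \<open>\<rho>\<close> is linear in \<open>x\<close> for the
  pointwise vector space structure on \<open>gl(V)\<close>.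
\<close>

locale leibniz_representation =
  leibniz_algebra sg bracket + V: fin_dim_complex_space sV
  for sg :: "complex \<Rightarrow> 'g::ab_group_add \<Rightarrow> 'g"
  and bracket :: "'g \<Rightarrow> 'g \<Rightarrow> 'g"
  and sV :: "complex \<Rightarrow> 'v::ab_group_add \<Rightarrow> 'v"
  and \<rho>L :: "'g \<Rightarrow> 'v \<Rightarrow> 'v"
  and \<rho>R :: "'g \<Rightarrow> 'v \<Rightarrow> 'v" +
  assumes linear_\<rho>L: "bilinear_map sg sV sV \<rho>L"
  and linear_\<rho>R: "bilinear_map sg sV sV \<rho>R"
  and \<rho>L_bracket: "\<rho>L (bracket x y) v = \<rho>L x (\<rho>L y v) - \<rho>L y (\<rho>L x v)"
  and \<rho>R_bracket: "\<rho>R (bracket x y) v = \<rho>L x (\<rho>R y v) - \<rho>R y (\<rho>L x v)"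
  and \<rho>R_bracket': "\<rho>R (bracket x y) v = \<rho>L x (\<rho>R y v) + \<rho>R y (\<rho>R x v)"

locale leibniz_2_cocycle =
  leibniz_representation sg bracket sV \<rho>L \<rho>R
  for sg :: "complex \<Rightarrow> 'g::ab_group_add \<Rightarrow> 'g"
  and bracket :: "'g \<Rightarrow> 'g \<Rightarrow> 'g"
  and sV :: "complex \<Rightarrow> 'v::ab_group_add \<Rightarrow> 'v"
  and \<rho>L :: "'g \<Rightarrow> 'v \<Rightarrow> 'v"
  and \<rho>R :: "'g \<Rightarrow> 'v \<Rightarrow> 'v"
  and H :: "'g \<Rightarrow> 'g \<Rightarrow> 'v" +
  assumes bilinear_H: "bilinear_map sg sg sV H"
  and cocycle: "\<rho>L x (H y z) - \<rho>L y (H x z) - \<rho>R z (H x y)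
    - H (bracket x y) z - H y (bracket x z) + H x (bracket y z) = 0"

locale twisted_relative_rota_baxter =
  leibniz_2_cocycle sg bracket sV \<rho>L \<rho>R H
  for sg :: "complex \<Rightarrow> 'g::ab_group_add \<Rightarrow> 'g"
  and bracket :: "'g \<Rightarrow> 'g \<Rightarrow> 'g"
  and sV :: "complex \<Rightarrow> 'v::ab_group_add \<Rightarrow> 'v"
  and \<rho>L :: "'g \<Rightarrow> 'v \<Rightarrow> 'v"
  and \<rho>R :: "'g \<Rightarrow> 'v \<Rightarrow> 'v"
  and H :: "'g \<Rightarrow> 'g \<Rightarrow> 'v"
  and K :: "'v \<Rightarrow> 'g" +
  assumes linear_K: "Vector_Spaces.linear sV sg K"
  and rota_baxter: "bracket (K u) (K v) = K (\<rho>L (K u) v + \<rho>R (K v) u + H (K u) (K v))"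

end

theory Submission
  imports Defs
begin

text \<open>The Rota-Baxter identity says that \<open>K\<close> sends the new bracket on
  \<open>V\<close> to the bracket of the algebra. So in the Leibniz identity for \<open>u\<close>,
  \<open>v\<close>, \<open>w\<close> every nested \<open>K\<close> turns into a bracket such as
  \<open>bracket (K u) (K v)\<close>, and by bilinearity the identity splits into four groups of
  terms. Those in \<open>w\<close> cancel by \<open>\<rho>L_bracket\<close>, those in
  \<open>v\<close> by \<open>\<rho>R_bracket\<close>, those in \<open>u\<close> by
  \<open>\<rho>R_bracket'\<close>, and those in \<open>H\<close> alone by the cocycle condition at
  \<open>K u\<close>, \<open>K v\<close>, \<open>K w\<close>. Bilinearity of the new bracket is
  inherited from \<open>\<rho>L\<close>, \<open>\<rho>R\<close>, \<open>H\<close> and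
  \<open>K\<close>.\<close>

lemma bilinear_mapD:
  assumes "bilinear_map sa sb sc f"
  shows "f x (y + y') = f x y + f x y'" "f x (sb c y) = sc c (f x y)"
    "f (x + x') y = f x y + f x' y" "f (sa c x) y = sc c (f x y)"
  using assms unfolding bilinear_map_def Vector_Spaces.linear_iff by blast+

lemma (in twisted_relative_rota_baxter) leibniz_algebra_twisted_bracket:
  "leibniz_algebra sV (\<lambda>u v. \<rho>L (K u) v + \<rho>R (K v) u + H (K u) (K v))"
proof -
  have K: "K (u + v) = K u + K v" "K (sV c u) = sg c (K u)" for u v c
    using linear_K unfolding Vector_Spaces.linear_iff by blast+
  note bilin = bilinear_mapD[OF linear_\<rho>L] bilinear_mapD[OF linear_\<rho>R]
    bilinear_mapD[OF bilinear_H]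
  show ?thesis
  proof unfold_locales
    show "bilinear_map sV sV sV (\<lambda>u v. \<rho>L (K u) v + \<rho>R (K v) u + H (K u) (K v))"
      unfolding bilinear_map_def Vector_Spaces.linear_iff
      by (simp add: K bilin V.vector_space_axioms V.scale_right_distrib algebra_simps)
  next
    fix u v w
    \<comment> \<open>The group in \<open>v\<close>, solved for the term that occurs on the
      left-hand side of the Leibniz identity.\<close>
    have "\<rho>L (K u) (\<rho>R (K w) v) = \<rho>R (bracket (K u) (K w)) v + \<rho>R (K w) (\<rho>L (K u) v)"
      using \<rho>R_bracket[of "K u" "K w" v] by (simp add: algebra_simps)
    \<comment> \<open>The group in \<open>H\<close>: the cocycle condition, solved for the only term
      with a bracket on the left-hand side.\<close>
    moreover have "H (K u) (bracket (K v) (K w)) =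
        H (bracket (K u) (K v)) (K w) + H (K v) (bracket (K u) (K w)) + \<rho>R (K w) (H (K u) (K v))
        + \<rho>L (K v) (H (K u) (K w)) - \<rho>L (K u) (H (K v) (K w))"
      using cocycle[of "K u" "K v" "K w"] by (simp add: algebra_simps add_eq_0_iff)
    ultimately show "\<rho>L (K u) (\<rho>L (K v) w + \<rho>R (K w) v + H (K v) (K w))
        + \<rho>R (K (\<rho>L (K v) w + \<rho>R (K w) v + H (K v) (K w))) u
        + H (K u) (K (\<rho>L (K v) w + \<rho>R (K w) v + H (K v) (K w))) =
        \<rho>L (K (\<rho>L (K u) v + \<rho>R (K v) u + H (K u) (K v))) w
        + \<rho>R (K w) (\<rho>L (K u) v + \<rho>R (K v) u + H (K u) (K v))
        + H (K (\<rho>L (K u) v + \<rho>R (K v) u + H (K u) (K v))) (K w)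
        + (\<rho>L (K v) (\<rho>L (K u) w + \<rho>R (K w) u + H (K u) (K w))
        + \<rho>R (K (\<rho>L (K u) w + \<rho>R (K w) u + H (K u) (K w))) v
        + H (K v) (K (\<rho>L (K u) w + \<rho>R (K w) u + H (K u) (K w))))"
      \<comment> \<open>\<open>\<rho>R_bracket'\<close> is instantiated so that it expands only the
        action on \<open>u\<close>. The term \<open>\<rho>R (bracket (K u) (K w)) v\<close> must
        stay intact to match the first fact above, which comes from
        \<open>\<rho>R_bracket\<close>.\<close>
      unfolding rota_baxter[symmetric] \<rho>L_bracket \<rho>R_bracket'[of "K v" "K w" u]
      by (simp add: bilin algebra_simps)
  qed
qed

theorem proposition2p7:
  fixes sg :: "complex \<Rightarrow> 'g::ab_group_add \<Rightarrow> 'g"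
    and bracket :: "'g \<Rightarrow> 'g \<Rightarrow> 'g"
    and sV :: "complex \<Rightarrow> 'v::ab_group_add \<Rightarrow> 'v"
    and \<rho>L \<rho>R :: "'g \<Rightarrow> 'v \<Rightarrow> 'v"
    and H :: "'g \<Rightarrow> 'g \<Rightarrow> 'v"
    and K :: "'v \<Rightarrow> 'g"
  assumes "leibniz_algebra sg bracket"
    and "leibniz_representation sg bracket sV \<rho>L \<rho>R"
    and "leibniz_2_cocycle sg bracket sV \<rho>L \<rho>R H"
    and "twisted_relative_rota_baxter sg bracket sV \<rho>L \<rho>R H K"
  shows "leibniz_algebra sV (\<lambda>u v. \<rho>L (K u) v + \<rho>R (K v) u + H (K u) (K v))"
  using assms(4) by (rule twisted_relative_rota_baxter.leibniz_algebra_twisted_bracket)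

end
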